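(* Let $f:\mathbb{R}^n\to\mathbb{R}\cup\{+\infty\}$ be a proper, lower semicontinuous and $e$-quasiconvex function, where the error bifunction $e$ is upper semicontinuous on $\mathbb{R}^n\times\mathbb{R}^n$ and satisfies $$e(\lambda x,\lambda y)=\lambda e(x,y)\quad\text{for all } x,y\in\mathbb{R}^n \text{ and all } \lambda\ge 0 .$$ If $$f^{\infty}_{q}(u)-e(u,0)>0\quad\text{for all } u\in\mathbb{R}^n,\ u\ne 0$$ (that is, $f^{\infty}_q(u)>e(u,0)$), then $\operatorname{argmin}_{\mathbb{R}^n} f$ is nonempty and compact.
   Context: For $f:\mathbb{R}^n\to\mathbb{R}\cup\{+\infty\}$, $\operatorname{dom} f=\{x: f(x)<+\infty\}$; $f$ is proper if it never takes the value $-\infty$ and $\operatorname{dom} f\neq\emptyset$. $\operatorname{argmin}_{\mathbb{R}^n} f$ is the set of global minimizers of $f$. An error bifunction is a map $e:\mathbb{R}^n\times\mathbb{R}^n\to\mathbb{R}\cup\{+\infty\}$ such that $\operatorname{dom} e:=\{(x,y): e(x,y)<+\infty\}\neq\emptyset$, $e\ge 0$, and $e(x,y)=e(y,x)$ for all $(x,y)\in\operatorname{dom} e$. Let $e$ be an error bifunction with $\operatorname{dom} f\times\operatorname{dom} f\subseteq\operatorname{dom} e$. The function $f$ is $e$-quasiconvex if for all $x,y\in\mathbb{R}^n$ and all $t\in\,]0,1[$, $$f(tx+(1-t)y)\le \max\{f(x),f(y)\}+t(1-t)e(x,y).$$ The $q$-asymptotic function of a proper function $f$ is $$f^{\infty}_q(u):=\sup_{x\in\operatorname{dom}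 f}\ \sup_{t>0}\frac{f(x+tu)-f(x)}{t}.$$ The convention $0\cdot(+\infty)=0$ is used. *)

theory Defs
  imports "HOL-Analysis.Analysis"
begin

text \<open>Functions with values in the reals extended by plus infinity are modelled as
  \<open>ereal\<close>-valued functions; the value minus infinity is excluded by \<open>proper\<close> for \<open>f\<close> and by
  nonnegativity for error bifunctions. Multiplication on \<open>ereal\<close> satisfies \<open>0 * \<infinity> = 0\<close>.\<close>

definition edom :: "('a \<Rightarrow> ereal) \<Rightarrow> 'a set" where
  "edom f = {x. f x < \<infinity>}"

definition proper :: "('a \<Rightarrow> ereal) \<Rightarrow> bool" where
  "proper f \<longleftrightarrow> (\<forall>x. f x \<noteq> -\<infinity>) \<and> edom f \<noteq> {}"

definition argmin_set :: "('a \<Rightarrow> ereal) \<Rightarrow> 'a set" where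
  "argmin_set f = {x. is_arg_min f (\<lambda>_. True) x}"

definition lower_semicontinuous :: "('a::topological_space \<Rightarrow> ereal) \<Rightarrow> bool" where
  "lower_semicontinuous f \<longleftrightarrow> (\<forall>x. f x \<le> Liminf (at x) f)"

definition upper_semicontinuous :: "('a::topological_space \<Rightarrow> ereal) \<Rightarrow> bool" where
  "upper_semicontinuous f \<longleftrightarrow> (\<forall>x. Limsup (at x) f \<le> f x)"

definition error_bifunction :: "('a \<times> 'a \<Rightarrow> ereal) \<Rightarrow> bool" where
  "error_bifunction e \<longleftrightarrow>
     edom e \<noteq> {} \<and> (\<forall>x y. 0 \<le> e (x, y)) \<and> (\<forall>(x, y) \<in> edom e. e (x, y) = e (y, x))"

definition e_quasiconvex ::
    "('a::real_vector \<times> 'a \<Rightarrow> ereal) \<Rightarrow> ('a \<Rightarrow> ereal) \<Rightarrow> bool" where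
  "e_quasiconvex e f \<longleftrightarrow>
     (\<forall>x y. \<forall>t::real. 0 < t \<longrightarrow> t < 1 \<longrightarrow>
        f (t *\<^sub>R x + (1 - t) *\<^sub>R y) \<le> max (f x) (f y) + ereal (t * (1 - t)) * e (x, y))"

definition q_asymptotic :: "('a::real_vector \<Rightarrow> ereal) \<Rightarrow> 'a \<Rightarrow> ereal" where
  "q_asymptotic f u =
     (SUP x\<in>edom f. SUP t\<in>{0::real<..}. (f (x + t *\<^sub>R u) - f x) / ereal t)"

end

theory Submission
  imports Defs
begin

text \<open>If the sublevel sets just above \<open>Inf f\<close> were all unbounded, there would be a minimizing
  sequence \<open>X k\<close> with \<open>norm (X k) \<rightarrow> \<infinity>\<close> and \<open>X k / norm (X k) \<rightarrow> u\<close>. For \<open>x \<in> dom f\<close> and \<open>t > 0\<close>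
  the points \<open>(t / norm (X k)) X k + (1 - t / norm (X k)) x\<close> tend to \<open>x + t u\<close>; quasiconvexity,
  homogeneity and the semicontinuity assumptions give \<open>f (x + t u) \<le> f x + t e(u, 0)\<close>, because
  \<open>max (f x) (f (X k))\<close> tends to \<open>f x\<close> along a minimizing sequence. Hence the \<open>q\<close>-asymptotic
  function at \<open>u\<close> is at most \<open>e(u, 0)\<close>, a contradiction. So some sublevel set is bounded, and
  the direct method applies.\<close>

lemma lower_semicontinuous_le_of_tendsto:
  assumes lsc: "lower_semicontinuous f" and X: "X \<longlonglongrightarrow> x"
    and le: "\<forall>\<^sub>F k in sequentially. f (X k) \<le> c"
  shows "f x \<le> c"
proof (rule ccontr)
  assume "\<not> f x \<le> c"
  then have c: "c < f x" by simp
  also have "f x \<le> Liminf (at x) f"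
    using lsc by (simp add: lower_semicontinuous_def)
  finally have "\<forall>\<^sub>F y in at x. c < f y"
    by (rule less_LiminfD)
  \<comment> \<open>The filter \<open>at x\<close> omits \<open>x\<close> itself; the bound at
    \<open>x\<close> extends the estimate to a full neighbourhood, so the sequence may hit its
    limit.\<close>
  with c have "\<forall>\<^sub>F y in nhds x. c < f y"
    by (auto simp: eventually_nhds_conv_at)
  with X have "\<forall>\<^sub>F k in sequentially. c < f (X k)"
    by (auto simp: filterlim_iff)
  with le have "\<forall>\<^sub>F k in sequentially. False"
    by eventually_elim simp
  then show False by simp
qed

lemma upper_semicontinuous_eventually_less:
  assumes usc: "upper_semicontinuous g" and X: "X \<longlonglongrightarrow> x" and c: "g x < c"
  shows "\<forall>\<^sub>F k in sequentially. g (X k) < c"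
proof -
  have "Limsup (at x) g \<le> g x"
    using usc by (simp add: upper_semicontinuous_def)
  then have "\<forall>\<^sub>F y in at x. g y < c"
    using c by (intro Limsup_lessD) simp
  with c have "\<forall>\<^sub>F y in nhds x. g y < c"
    by (auto simp: eventually_nhds_conv_at)
  with X show ?thesis
    by (auto simp: filterlim_iff)
qed

text \<open>Strict real bounds \<open>c\<close> and \<open>d\<close> leave room for limit arguments,
  where only eventual strict inequalities are available. They also keep the arithmetic real; if
  \<open>E\<close> is infinite, no such \<open>c\<close> exists and the claim is trivial.\<close>

lemma q_asymptotic_le:
  assumes "proper f"
    and step: "\<And>x t c d. \<lbrakk>x \<in> edom f; 0 < t; E < ereal c; f x < ereal d\<rbrakk>
      \<Longrightarrow> f (x + t *\<^sub>R u) \<le> ereal (d + t * c)"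
  shows "q_asymptotic f u \<le> E"
  unfolding q_asymptotic_def
proof (intro SUP_least)
  fix x and t :: real
  assume x: "x \<in> edom f" and "t \<in> {0<..}"
  then have t: "0 < t" by simp
  obtain r where r: "f x = ereal r"
    using x assms(1) by (cases "f x") (auto simp: edom_def proper_def)
  show "(f (x + t *\<^sub>R u) - f x) / ereal t \<le> E"
  proof (rule ereal_le_real)
    fix c assume "E \<le> ereal c"
    have "f (x + t *\<^sub>R u) \<le> ereal (r + t * c)"
    proof (rule ereal_le_epsilon2)
      fix h :: real assume h: "0 < h"
      \<comment> \<open>The slack \<open>h\<close> is split evenly: \<open>t * (c' - c)\<close> is
        \<open>h / 2\<close>, and the other half goes into the bound on \<open>f x\<close>.\<close>
      define c' where "c' = c + h / (2 * t)"
      have "c < c'" using h t by (simp add: c'_def)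
      then have "ereal c < ereal c'" by simp
      with \<open>E \<le> ereal c\<close> have "E < ereal c'" by (rule le_less_trans)
      moreover have "f x < ereal (r + h / 2)" using r h by simp
      ultimately have "f (x + t *\<^sub>R u) \<le> ereal (r + h / 2 + t * c')"
        using step x t by blast
      moreover have "r + h / 2 + t * c' = r + t * c + h"
        using t by (simp add: c'_def field_simps)
      ultimately show "f (x + t *\<^sub>R u) \<le> ereal (r + t * c) + ereal h" by simp
    qed
    then show "(f (x + t *\<^sub>R u) - f x) / ereal t \<le> ereal c"
      using t r by (simp add: ereal_divide_le_pos ereal_minus_le add.commute)
  qed
qed

lemma q_asymptotic_le_of_minimizing_sequence:
  fixes f :: "'a::euclidean_space \<Rightarrow> ereal"
  assumes e0: "\<And>x y. 0 \<le> e (x, y)"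
    and f: "proper f" "lower_semicontinuous f" "e_quasiconvex e f"
    and usc: "upper_semicontinuous e"
    and hom: "\<And>x y c. 0 \<le> c \<Longrightarrow> e (c *\<^sub>R x, c *\<^sub>R y) = ereal c * e (x, y)"
    and minim: "(\<lambda>k. f (X k)) \<longlonglongrightarrow> (INF x. f x)"
    and infty: "filterlim (\<lambda>k. norm (X k)) at_top sequentially"
    and dir: "(\<lambda>k. X k /\<^sub>R norm (X k)) \<longlonglongrightarrow> u"
  shows "q_asymptotic f u \<le> e (u, 0)"
  using f(1)
proof (rule q_asymptotic_le)
  fix x and t c d :: real
  assume t: "0 < t" and c: "e (u, 0) < ereal c" and d: "f x < ereal d"
  have c0: "0 < c"
    using e0[of u 0] c by (metis ereal_less(2) le_less_trans)
  have inv: "(\<lambda>k. inverse (norm (X k))) \<longlonglongrightarrow> 0"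
    using infty by (rule tendsto_inverse_0_at_top)
  \<comment> \<open>With this weight \<open>s k *\<^sub>R X k\<close> is \<open>t\<close> times the
    unit direction, while the weight of \<open>x\<close> tends to 1.\<close>
  define s where "s k = t * inverse (norm (X k))" for k
  define z where "z k = s k *\<^sub>R X k + (1 - s k) *\<^sub>R x" for k
  have s: "s \<longlonglongrightarrow> 0"
    unfolding s_def using tendsto_mult_right_zero[OF inv] .
  have "(\<lambda>k. t *\<^sub>R (X k /\<^sub>R norm (X k)) + (1 - s k) *\<^sub>R x) \<longlonglongrightarrow> t *\<^sub>R u + (1 - 0) *\<^sub>R x"
    by (intro tendsto_intros dir s)
  then have z: "z \<longlonglongrightarrow> x + t *\<^sub>R u"
    by (simp add: z_def[abs_def] s_def add.commute)
  have "(\<lambda>k. (X k /\<^sub>R norm (X k), x /\<^sub>R norm (X k))) \<longlonglongrightarrow> (u, 0 *\<^sub>R x)"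
    by (intro tendsto_intros dir inv)
  then have ev_e: "\<forall>\<^sub>F k in sequentially. e (X k /\<^sub>R norm (X k), x /\<^sub>R norm (X k)) < ereal c"
    using upper_semicontinuous_eventually_less[OF usc] c by simp
  \<comment> \<open>One real \<open>d\<close> thus bounds both terms of the maximum eventually, even
    if the infimum were minus infinity.\<close>
  have "(INF x. f x) < ereal d"
    using d by (meson INF_lower UNIV_I le_less_trans)
  with minim have ev_f: "\<forall>\<^sub>F k in sequentially. f (X k) < ereal d"
    by (rule order_tendstoD)
  have ev_s: "\<forall>\<^sub>F k in sequentially. s k < 1"
    using s by (rule order_tendstoD) simp
  have ev_n: "\<forall>\<^sub>F k in sequentially. 0 < norm (X k)"
    using infty unfolding filterlim_at_top_dense by (rule spec)
  have "\<forall>\<^sub>F k in sequentially. f (z k) \<le> ereal (d + t * c)"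
    using ev_e ev_f ev_s ev_n
  proof eventually_elim
    case (elim k)
    let ?n = "norm (X k)"
    have s0: "0 < s k" using elim(4) t by (simp add: s_def)
    \<comment> \<open>Homogeneity moves the error term to a pair close to \<open>(u, 0)\<close>. The
      factor \<open>?n\<close> it costs cancels against the denominator of
      \<open>s k\<close>.\<close>
    have "e (X k, x) = e (?n *\<^sub>R (X k /\<^sub>R ?n), ?n *\<^sub>R (x /\<^sub>R ?n))"
      using elim(4) by simp
    also have "\<dots> = ereal ?n * e (X k /\<^sub>R ?n, x /\<^sub>R ?n)"
      by (rule hom) simp
    also have "\<dots> \<le> ereal ?n * ereal c"
      using elim(1) by (intro ereal_mult_left_mono) auto
    finally have "e (X k, x) \<le> ereal (?n * c)" by simp
    then have "ereal (s k * (1 - s k)) * e (X k, x) \<le> ereal (s k * (1 - s k)) * ereal (?n * c)"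
      using s0 elim(3) by (intro ereal_mult_left_mono) auto
    also have "\<dots> = ereal (t * c * (1 - s k))"
      using elim(4) by (simp add: s_def field_simps)
    also have "\<dots> \<le> ereal (t * c)"
      using s0 t c0 by (simp add: mult_left_le)
    finally have 1: "ereal (s k * (1 - s k)) * e (X k, x) \<le> ereal (t * c)" .
    have "f (z k) \<le> max (f (X k)) (f x) + ereal (s k * (1 - s k)) * e (X k, x)"
      using f(3) s0 elim(3) unfolding e_quasiconvex_def z_def by blast
    also have "\<dots> \<le> ereal d + ereal (t * c)"
      using d elim(2) 1 by (intro add_mono) auto
    finally show ?case by simp
  qed
  with f(2) z show "f (x + t *\<^sub>R u) \<le> ereal (d + t * c)"
    by (rule lower_semicontinuous_le_of_tendsto)
qed

lemma bounded_sublevel_set: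
  fixes f :: "'a::euclidean_space \<Rightarrow> ereal"
  assumes e0: "\<And>x y. 0 \<le> e (x, y)"
    and f: "proper f" "lower_semicontinuous f" "e_quasiconvex e f"
    and usc: "upper_semicontinuous e"
    and hom: "\<And>x y c. 0 \<le> c \<Longrightarrow> e (c *\<^sub>R x, c *\<^sub>R y) = ereal c * e (x, y)"
    and pos: "\<And>u. u \<noteq> 0 \<Longrightarrow> e (u, 0) < q_asymptotic f u"
  obtains d where "(INF x. f x) < d" and "bounded {x. f x < d}"
proof (rule ccontr)
  let ?m = "INF x. f x"
  assume "\<not> thesis"
  with that have unb: "\<not> bounded {x. f x < d}" if "?m < d" for d
    using that by blast
  \<comment> \<open>Finiteness from above makes \<open>{?m<..}\<close> nonempty with infimum
    \<open>?m\<close>, so levels strictly above \<open>?m\<close> can converge to it.\<close>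
  have "?m < \<infinity>"
    using f(1) unfolding proper_def edom_def INF_less_iff by auto
  then have "{?m<..} \<noteq> {}" and Inf_m: "Inf {?m<..} = ?m"
    by (auto intro!: Inf_greaterThan)
  then obtain d where d: "\<And>k. ?m < d k" and "d \<longlonglongrightarrow> ?m"
    using Inf_as_limit[of "{?m<..}"] by (auto simp: Inf_m)
  \<comment> \<open>A single choice makes the sequence both minimizing and divergent in
    norm.\<close>
  have "\<exists>x. f x < d k \<and> real k < norm x" for k
    using unb[OF d[of k]] by (auto simp: bounded_iff not_le)
  then obtain X where X: "\<And>k. f (X k) < d k" "\<And>k. real k < norm (X k)"
    by metis
  have minim: "(\<lambda>k. f (X k)) \<longlonglongrightarrow> ?m"
    by (rule tendsto_sandwich[OF _ _ tendsto_const \<open>d \<longlonglongrightarrow> ?m\<close>])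
       (auto intro!: always_eventually INF_lower less_imp_le[OF X(1)])
  have infty: "filterlim (\<lambda>k. norm (X k)) at_top sequentially"
    by (rule filterlim_at_top_mono[OF filterlim_real_sequentially])
       (auto intro!: always_eventually less_imp_le[OF X(2)])
  have X0: "X k \<noteq> 0" for k
    using X(2)[of k] by auto
  have "\<forall>k. X k /\<^sub>R norm (X k) \<in> sphere 0 1"
    using X0 by simp
  from seq_compactE[OF compact_sphere[THEN compact_imp_seq_compact] this]
  obtain u r where u: "u \<in> sphere 0 1" and r: "strict_mono r"
    and dir: "((\<lambda>k. X k /\<^sub>R norm (X k)) \<circ> r) \<longlonglongrightarrow> u"
    by blast
  have "q_asymptotic f u \<le> e (u, 0)"
  proof (rule q_asymptotic_le_of_minimizing_sequence[OF e0 f usc hom])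
    show "(\<lambda>k. f ((X \<circ> r) k)) \<longlonglongrightarrow> ?m"
      using LIMSEQ_subseq_LIMSEQ[OF minim r] by (simp add: o_def)
    show "filterlim (\<lambda>k. norm ((X \<circ> r) k)) at_top sequentially"
      using filterlim_compose[OF infty filterlim_subseq[OF r]] by simp
    show "(\<lambda>k. (X \<circ> r) k /\<^sub>R norm ((X \<circ> r) k)) \<longlonglongrightarrow> u"
      using dir by (simp add: o_def)
  qed auto
  moreover have "u \<noteq> 0" using u by auto
  ultimately show False using pos[of u] by (simp add: not_less[symmetric])
qed

text \<open>As a sublevel set, the set of minimizers inherits closedness from lower semicontinuity
  and boundedness from any higher level.\<close>

lemma argmin_set_eq: "argmin_set f = {x. f x \<le> (INF y. f y)}" for f :: "'a \<Rightarrow> ereal"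
  by (auto simp: argmin_set_def is_arg_min_def le_INF_iff not_less)

lemma argmin_set_nonempty_compact:
  fixes f :: "'a::euclidean_space \<Rightarrow> ereal"
  assumes lsc: "lower_semicontinuous f"
    and d: "(INF x. f x) < d" and bdd: "bounded {x. f x < d}"
  shows "argmin_set f \<noteq> {} \<and> compact (argmin_set f)"
proof
  let ?m = "INF x. f x"
  obtain v where v: "\<And>k. v k \<in> range f" and v_lim: "v \<longlonglongrightarrow> ?m"
    using Inf_as_limit[of "range f"] by auto
  from v have "\<forall>k. \<exists>x. v k = f x" by auto
  then obtain X where "\<And>k. v k = f (X k)" by metis
  then have "v = (\<lambda>k. f (X k))" by (rule ext)
  with v_lim have X: "(\<lambda>k. f (X k)) \<longlonglongrightarrow> ?m" by simp
  obtain N where N: "\<And>k. N \<le> k \<Longrightarrow> f (X k) < d"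
    using order_tendstoD(2)[OF X d] by (auto simp: eventually_sequentially)
  \<comment> \<open>Dropping the first \<open>N\<close> terms puts the whole sequence into the
    bounded sublevel set.\<close>
  let ?Y = "\<lambda>k. X (k + N)"
  have "bounded (range ?Y)"
    using bdd by (rule bounded_subset) (auto intro: N)
  then obtain l r where r: "strict_mono r" and l: "(?Y \<circ> r) \<longlonglongrightarrow> l"
    using bounded_imp_convergent_subsequence by blast
  have Y: "(\<lambda>k. f ((?Y \<circ> r) k)) \<longlonglongrightarrow> ?m"
    using LIMSEQ_subseq_LIMSEQ[OF LIMSEQ_ignore_initial_segment[OF X, of N] r]
    by (simp add: o_def)
  have "f l \<le> ?m"
  \<comment> \<open>The values along the subsequence need not be at most \<open>?m\<close>, but they
    eventually lie below any \<open>c\<close> above it.\<close>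
  proof (rule dense_ge)
    fix c assume "?m < c"
    with Y have "\<forall>\<^sub>F k in sequentially. f ((?Y \<circ> r) k) < c"
      by (rule order_tendstoD)
    then have "\<forall>\<^sub>F k in sequentially. f ((?Y \<circ> r) k) \<le> c"
      by eventually_elim simp
    with lsc l show "f l \<le> c"
      by (rule lower_semicontinuous_le_of_tendsto)
  qed
  then show "argmin_set f \<noteq> {}"
    by (auto simp: argmin_set_eq)
  have "bounded (argmin_set f)"
    using bdd by (rule bounded_subset) (use d in \<open>auto simp: argmin_set_eq\<close>)
  moreover have "closed (argmin_set f)"
    unfolding closed_sequential_limits argmin_set_eq
    using lower_semicontinuous_le_of_tendsto[OF lsc] by (auto intro: always_eventually)
  ultimately show "compact (argmin_set f)"
    by (simp add: compact_eq_bounded_closed)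
qed

theorem theorem12:
  fixes f :: "real ^ 'n \<Rightarrow> ereal"
    and e :: "(real ^ 'n) \<times> (real ^ 'n) \<Rightarrow> ereal"
  assumes "error_bifunction e"
    and "edom f \<times> edom f \<subseteq> edom e"
    and "proper f"
    and "lower_semicontinuous f"
    and "e_quasiconvex e f"
    and "upper_semicontinuous e"
    and "\<forall>x y. \<forall>c::real. 0 \<le> c \<longrightarrow> e (c *\<^sub>R x, c *\<^sub>R y) = ereal c * e (x, y)"
    and "\<forall>u. u \<noteq> 0 \<longrightarrow> q_asymptotic f u > e (u, 0)"
  shows "argmin_set f \<noteq> {} \<and> compact (argmin_set f)"
proof -
  have "\<And>x y. 0 \<le> e (x, y)"
    using assms(1) by (simp add: error_bifunction_def)
  then obtain d where "(INF x. f x) < d" and "bounded {x. f x < d}"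
    using bounded_sublevel_set[of e f] assms by blast
  with assms(4) show ?thesis
    by (rule argmin_set_nonempty_compact)
qed

end
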